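(* Suppose that $\mu_X$ and $\mu_Y$ are probability measures and that there exist $j_0\in\mathcal{J}$ and $k_0\in\mathcal{K}$ such that $p_{j_0}^X(x)=p_{k_0}^Y(y)=1$ for all $x\in\mathcal{X}$ and $y\in\mathcal{Y}$. Assume that $\bar p:=\sup_{j\in\mathcal{J},k\in\mathcal{K}}\|p_{jk}\|_\infty<\infty$, and fix $\gamma\in(0,1)$ and $\xi=(\theta,r,A)\in\Xi$ such that the sets $\{(j,k)\in\mathcal{J}\times\mathcal{K}:\theta_{jk}\le T\}$ are finite for each $T\in(0,\infty)$. Then there exists $c=c(\gamma,A)\in(0,\infty)$, depending only on $\gamma$ and $A$, such that $$\tilde\rho^*(n,\gamma,\xi)\ge c\sup_{m\in\mathbb{N}}\min\biggl(\frac{r}{\theta_{\omega(m)}},\ \frac{m^{1/4}}{n^{1/2}},\ \frac{1}{m^{1/2}\bar p}\biggr).$$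
   Context: $n\in\mathbb{N}$ is the sample size. Let $(\mathcal{X},\mathcal{A},\mu_X)$ and $(\mathcal{Y},\mathcal{B},\mu_Y)$ be separable, $\sigma$-finite measure spaces (a measure space $(\mathcal{Z},\mathcal{C},\nu)$ is separable if $\mathcal{C}$, equipped with the pseudo-metric $d(A,B)=\nu(A\triangle B)$, has a countable dense subset). $(p_j^X)_{j\in\mathcal{J}}$ and $(p_k^Y)_{k\in\mathcal{K}}$ are orthonormal bases of $L^2(\mu_X)$ and $L^2(\mu_Y)$ (real-valued functions), with $\mathcal{J},\mathcal{K}$ countable; $\mu:=\mu_X\otimes\mu_Y$ and $p_{jk}(x,y):=p_j^X(x)p_k^Y(y)$; $\|\cdot\|_\infty$ is the supremum norm. $\mathcal{F}$ is the set of $f\in L^2(\mu)$ with $f\ge0$ $\mu$-a.e. and $\int f\,d\mu=1$. For $f\in\mathcal{F}$, $f_X(x):=\int f(x,y)\,d\mu_Y(y)$, $f_Y(y):=\int f(x,y)\,d\mu_X(x)$, $a_{jk}(f):=\int fp_{jk}\,d\mu$, $a_{j\bullet}(f):=\int f_Xp_j^X\,d\mu_X$, $a_{\bullet k}(f):=\int f_Yp_k^Y\,d\mu_Y$, $$D(f):=\int\{f(x,y)-f_X(x)f_Y(y)\}^2\,d\mu(x,y),\qquad S_\theta(f):=\sum_{j,k}\theta_{jk}^2\{a_{jk}(f)-a_{j\bullet}(f)a_{\bullet k}(f)\}^2,$$ with the convention $\infty\cdot0=0$. $\Xi:=[0,\infty]^{\mathcal{J}\times\mathcal{K}}\times(0,\infty)\times[1,\infty)$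 and, for $\xi=(\theta,r,A)\in\Xi$, $\rho>0$, $$\mathcal{F}_\xi(\rho):=\{f\in\mathcal{F}:D(f)\ge\rho^2,\ S_\theta(f)\le r^2,\ \max(\|f\|_\infty,\|f_X\|_\infty,\|f_Y\|_\infty)\le A\}.$$ Convention: since the terms with $j=j_0$ or $k=k_0$ do not contribute to $D$ or $S_\theta$, one sets $\theta_{jk}=\infty$ whenever $j=j_0$ or $k=k_0$. The set $\{(j,k):\theta_{jk}<\infty\}$ is taken to be infinite, and $\omega:\mathbb{N}\to\{(j,k):\theta_{jk}<\infty\}$ is a bijection with $\theta_{\omega(1)}\le\theta_{\omega(2)}\le\cdots$, where $\theta_{\omega(m)}$ means $\theta_{jk}$ if $\omega(m)=(j,k)$. ($r/0=\infty$.) Let $\Psi$ be the set of all measurable $\psi:(\mathcal{X}\times\mathcal{Y})^n\to[0,1]$, and $\mathbb{E}_f(\psi)$ the expectation of $\psi(X_1,Y_1,\ldots,X_n,Y_n)$ when the pairs are i.i.d. with density $f$ with respect to $\mu$. Define $$\tilde{\mathcal{R}}(n,\xi,\rho):=\inf_{\psi\in\Psi}\Bigl\{\mathbb{E}_{p_{j_0k_0}}(\psi)+\sup_{f\in\mathcal{F}_\xi(\rho)}\mathbb{E}_f(1-\psi)\Bigr\},\qquad\tilde\rho^*(n,\gamma,\xi):=\inf\{\rho>0:\tilde{\mathcal{R}}(n,\xi,\rho)\le\gamma\},$$ with the supremum over an empty class equal to $0$.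
   Formalization: A > 1 is assumed instead of A ≥ 1: at A = 1 the class F_ξ(ρ) is empty for every ρ > 0, so the separation radius is 0 while the right-hand side is positive. Also, c is chosen for fixed underlying types of X, Y, J, K; a uniform c follows by transfer to sequence space. *)

theory Defs
  imports "HOL-Probability.Probability"
begin

definition separable_measure :: "'a measure \<Rightarrow> bool" where
  "separable_measure M \<longleftrightarrow>
     (\<exists>\<C>\<subseteq>sets M. countable \<C> \<and>
        (\<forall>A\<in>sets M. \<forall>\<epsilon>>0. \<exists>B\<in>\<C>. emeasure M (sym_diff A B) < ennreal \<epsilon>))"

text \<open>Elements of \<open>L\<^sup>2\<close> are represented by functions, not by classes modulo null sets.\<close>

definition square_integrable :: "'a measure \<Rightarrow> ('a \<Rightarrow> real) \<Rightarrow> bool" where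
  "square_integrable M f \<longleftrightarrow>
     f \<in> borel_measurable M \<and> integrable M (\<lambda>x. (f x)\<^sup>2)"

text \<open>Orthonormal in \<open>L\<^sup>2\<close> with dense linear span.\<close>

definition orthonormal_basis :: "'a measure \<Rightarrow> 'i set \<Rightarrow> ('i \<Rightarrow> 'a \<Rightarrow> real) \<Rightarrow> bool" where
  "orthonormal_basis M I p \<longleftrightarrow>
     (\<forall>i\<in>I. square_integrable M (p i)) \<and>
     (\<forall>i\<in>I. \<forall>j\<in>I. (\<integral>x. p i x * p j x \<partial>M) = (if i = j then 1 else 0)) \<and>
     (\<forall>f. square_integrable M f \<longrightarrow>
        (\<forall>\<epsilon>>0. \<exists>F a. finite F \<and> F \<subseteq> I \<and>
           (\<integral>x. (f x - (\<Sum>i\<in>F. a i * p i x))\<^sup>2 \<partial>M) < \<epsilon>))"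

text \<open>The supremum is over all points of the space; it is not an essential supremum.\<close>

definition sup_norm :: "'a measure \<Rightarrow> ('a \<Rightarrow> real) \<Rightarrow> ennreal" where
  "sup_norm M f = (SUP x\<in>space M. ennreal \<bar>f x\<bar>)"

definition tensor :: "('x \<Rightarrow> real) \<Rightarrow> ('y \<Rightarrow> real) \<Rightarrow> 'x \<times> 'y \<Rightarrow> real" where
  "tensor p q = (\<lambda>(x, y). p x * q y)"

definition density_class :: "'x measure \<Rightarrow> 'y measure \<Rightarrow> ('x \<times> 'y \<Rightarrow> real) set" where
  "density_class MX MY =
     {f. square_integrable (MX \<Otimes>\<^sub>M MY) f \<and> (AE z in MX \<Otimes>\<^sub>M MY. 0 \<le> f z) \<and>
         has_bochner_integral (MX \<Otimes>\<^sub>M MY) f 1}"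

definition marg_X :: "'y measure \<Rightarrow> ('x \<times> 'y \<Rightarrow> real) \<Rightarrow> 'x \<Rightarrow> real" where
  "marg_X MY f x = (\<integral>y. f (x, y) \<partial>MY)"

definition marg_Y :: "'x measure \<Rightarrow> ('x \<times> 'y \<Rightarrow> real) \<Rightarrow> 'y \<Rightarrow> real" where
  "marg_Y MX f y = (\<integral>x. f (x, y) \<partial>MX)"

definition dep_measure :: "'x measure \<Rightarrow> 'y measure \<Rightarrow> ('x \<times> 'y \<Rightarrow> real) \<Rightarrow> ennreal" where
  "dep_measure MX MY f =
     (\<integral>\<^sup>+(x, y). ennreal ((f (x, y) - marg_X MY f x * marg_Y MX f y)\<^sup>2) \<partial>(MX \<Otimes>\<^sub>M MY))"

definition coeff_diff ::
  "'x measure \<Rightarrow> 'y measure \<Rightarrow> ('x \<Rightarrow> real) \<Rightarrow> ('y \<Rightarrow> real) \<Rightarrow> ('x \<times> 'y \<Rightarrow> real) \<Rightarrow> real" where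
  "coeff_diff MX MY p q f =
     (\<integral>z. f z * tensor p q z \<partial>(MX \<Otimes>\<^sub>M MY))
     - (\<integral>x. marg_X MY f x * p x \<partial>MX) * (\<integral>y. marg_Y MX f y * q y \<partial>MY)"

text \<open>In \<^typ>\<open>ennreal\<close>, \<open>\<infinity> * 0 = 0\<close> and every family is summable.\<close>

definition smoothness ::
  "'x measure \<Rightarrow> 'y measure \<Rightarrow> 'j set \<Rightarrow> 'k set \<Rightarrow> ('j \<Rightarrow> 'x \<Rightarrow> real) \<Rightarrow> ('k \<Rightarrow> 'y \<Rightarrow> real) \<Rightarrow>
   ('j \<times> 'k \<Rightarrow> ennreal) \<Rightarrow> ('x \<times> 'y \<Rightarrow> real) \<Rightarrow> ennreal" where
  "smoothness MX MY J K pX pY \<theta> f =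
     (\<Sum>\<^sub>\<infinity>(j, k)\<in>J \<times> K. (\<theta> (j, k))\<^sup>2 * ennreal ((coeff_diff MX MY (pX j) (pY k) f)\<^sup>2))"

definition alternatives ::
  "'x measure \<Rightarrow> 'y measure \<Rightarrow> 'j set \<Rightarrow> 'k set \<Rightarrow> ('j \<Rightarrow> 'x \<Rightarrow> real) \<Rightarrow> ('k \<Rightarrow> 'y \<Rightarrow> real) \<Rightarrow>
   ('j \<times> 'k \<Rightarrow> ennreal) \<Rightarrow> real \<Rightarrow> real \<Rightarrow> real \<Rightarrow> ('x \<times> 'y \<Rightarrow> real) set" where
  "alternatives MX MY J K pX pY \<theta> r A \<rho> =
     {f \<in> density_class MX MY.
        dep_measure MX MY f \<ge> ennreal (\<rho>\<^sup>2) \<and>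
        smoothness MX MY J K pX pY \<theta> f \<le> ennreal (r\<^sup>2) \<and>
        max (sup_norm (MX \<Otimes>\<^sub>M MY) f)
          (max (sup_norm MX (marg_X MY f)) (sup_norm MY (marg_Y MX f))) \<le> ennreal A}"

definition tests :: "'z measure \<Rightarrow> nat \<Rightarrow> ((nat \<Rightarrow> 'z) \<Rightarrow> real) set" where
  "tests M n =
     {\<psi> \<in> borel_measurable (Pi\<^sub>M {1..n} (\<lambda>_. M)).
        \<forall>z\<in>space (Pi\<^sub>M {1..n} (\<lambda>_. M)). 0 \<le> \<psi> z \<and> \<psi> z \<le> 1}"

definition sample_expectation ::
  "'z measure \<Rightarrow> nat \<Rightarrow> ('z \<Rightarrow> real) \<Rightarrow> ((nat \<Rightarrow> 'z) \<Rightarrow> real) \<Rightarrow> real" where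
  "sample_expectation M n f \<psi> =
     (\<integral>z. \<psi> z \<partial>(Pi\<^sub>M {1..n} (\<lambda>_. density M (\<lambda>x. ennreal (f x)))))"

text \<open>The null hypothesis is the single density \<open>f0\<close>. The supremum of an empty set
  of \<^typ>\<open>ennreal\<close> values is \<open>0\<close>.\<close>

definition minimax_risk ::
  "'x measure \<Rightarrow> 'y measure \<Rightarrow> 'j set \<Rightarrow> 'k set \<Rightarrow> ('j \<Rightarrow> 'x \<Rightarrow> real) \<Rightarrow> ('k \<Rightarrow> 'y \<Rightarrow> real) \<Rightarrow>
   ('x \<times> 'y \<Rightarrow> real) \<Rightarrow> nat \<Rightarrow> ('j \<times> 'k \<Rightarrow> ennreal) \<Rightarrow> real \<Rightarrow> real \<Rightarrow> real \<Rightarrow> ennreal" where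
  "minimax_risk MX MY J K pX pY f0 n \<theta> r A \<rho> =
     (INF \<psi>\<in>tests (MX \<Otimes>\<^sub>M MY) n.
        ennreal (sample_expectation (MX \<Otimes>\<^sub>M MY) n f0 \<psi>) +
        (SUP f\<in>alternatives MX MY J K pX pY \<theta> r A \<rho>.
           ennreal (sample_expectation (MX \<Otimes>\<^sub>M MY) n f (\<lambda>z. 1 - \<psi> z))))"

definition minimax_separation ::
  "'x measure \<Rightarrow> 'y measure \<Rightarrow> 'j set \<Rightarrow> 'k set \<Rightarrow> ('j \<Rightarrow> 'x \<Rightarrow> real) \<Rightarrow> ('k \<Rightarrow> 'y \<Rightarrow> real) \<Rightarrow>
   ('x \<times> 'y \<Rightarrow> real) \<Rightarrow> nat \<Rightarrow> real \<Rightarrow> ('j \<times> 'k \<Rightarrow> ennreal) \<Rightarrow> real \<Rightarrow> real \<Rightarrow> ennreal" where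
  "minimax_separation MX MY J K pX pY f0 n \<gamma> \<theta> r A =
     Inf {ennreal \<rho> | \<rho>. \<rho> > 0 \<and> minimax_risk MX MY J K pX pY f0 n \<theta> r A \<rho> \<le> ennreal \<gamma>}"

definition basis_bound ::
  "'x measure \<Rightarrow> 'y measure \<Rightarrow> 'j set \<Rightarrow> 'k set \<Rightarrow> ('j \<Rightarrow> 'x \<Rightarrow> real) \<Rightarrow> ('k \<Rightarrow> 'y \<Rightarrow> real) \<Rightarrow>
   ennreal" where
  "basis_bound MX MY J K pX pY =
     (SUP (j, k)\<in>J \<times> K. sup_norm (MX \<Otimes>\<^sub>M MY) (tensor (pX j) (pY k)))"

end

theory Submission
  imports Defs
begin

text \<open>
  The bound is a Bayesian argument in the style of Le Cam and Ingster. The null density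
  is constantly \<open>1\<close>. For each \<open>m\<close>, it is perturbed along the \<open>m\<close> product basis functions with the
  smallest weights \<open>\<theta>\<close>:
  \[ f_\varepsilon = 1 + \delta \sum_{l \le m} \varepsilon_l\, p_{\omega(l)},
     \qquad \varepsilon \in \{-1, 1\}^m, \quad \delta = \rho / \sqrt m . \]
  Weights are infinite on the row of \<open>j\<^sub>0\<close> and the column of \<open>k\<^sub>0\<close>, so every direction used is a
  genuine interaction: it integrates to \<open>0\<close> in each variable separately. Hence both marginals of
  \<open>f\<^sub>\<epsilon>\<close> stay constantly \<open>1\<close>, the dependence measure is exactly \<open>m \<delta>\<^sup>2 = \<rho>\<^sup>2\<close>, and each of the three
  terms in the minimum pays for one requirement on \<open>\<rho>\<close>.

  \<^item> \<open>\<rho> \<le> r / \<theta> (\<omega> m)\<close> gives the smoothness constraint, because \<open>\<theta> (\<omega> m)\<close> is the largest weight used.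
  \<^item> \<open>\<rho> \<surd>m P\<close> bounds the perturbation uniformly (\<open>P\<close> being a bound on the product basis functions), so
    if it is small then \<open>f\<^sub>\<epsilon>\<close> is nonnegative and at most \<open>A\<close>; this is where \<open>A > 1\<close> enters.
  \<^item> \<open>\<rho> \<le> c m\<^sup>1\<^sup>/\<^sup>4 / n\<^sup>1\<^sup>/\<^sup>2\<close> makes the alternatives undetectable on average.

  For the last point, a test cannot separate the null from the uniform mixture of the \<open>f\<^sub>\<epsilon>\<close> better
  than the \<open>L\<^sup>1\<close> distance of the mixture likelihood \<open>L\<close> from \<open>1\<close>, and the second moment of \<open>L\<close> is
  explicit. Orthonormality gives
  \<open>\<integral> f\<^sub>\<epsilon> f\<^sub>\<epsilon>\<^sub>' = 1 + \<delta>\<^sup>2 \<langle>\<epsilon>, \<epsilon>'\<rangle>\<close>, and the average over signs of the \<open>n\<close>-th power of this is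
  at most \<open>(cosh (n \<delta>\<^sup>2))\<^sup>m \<le> exp (m (n \<delta>\<^sup>2)\<^sup>2) \<le> exp (c\<^sup>4)\<close>. The cancellation between random signs
  is what yields the exponent \<open>1/4\<close>: a single alternative would only be hidden for \<open>\<rho>\<close> of order
  \<open>n\<^sup>-\<^sup>1\<^sup>/\<^sup>2\<close>.

  The testing part is \<open>testing_error_ge_of_second_moment\<close>, the sign average is
  \<open>sum_sign_overlap_power_le\<close>, the membership of \<open>f\<^sub>\<epsilon>\<close> in the alternatives is
  \<open>perturbed_in_alternatives\<close>, and \<open>minimax_separation_ge\<close> chooses the constants.
\<close>

section \<open>Testing a null against a mixture of product densities\<close>

lemma PiM_density:
  fixes f :: "'a \<Rightarrow> ennreal"
  assumes "finite I" "sigma_finite_measure M" "sigma_finite_measure (density M f)"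
    and f[measurable]: "f \<in> borel_measurable M"
  shows "Pi\<^sub>M I (\<lambda>_. density M f) = density (Pi\<^sub>M I (\<lambda>_. M)) (\<lambda>z. \<Prod>i\<in>I. f (z i))"
proof (rule sym, rule product_sigma_finite.PiM_eqI)
  show "product_sigma_finite (\<lambda>_. density M f)"
    using assms(3) by (simp add: product_sigma_finite_def)
  interpret P: product_sigma_finite "\<lambda>_. M"
    using assms(2) by (simp add: product_sigma_finite_def)
  show "sets (density (Pi\<^sub>M I (\<lambda>_. M)) (\<lambda>z. \<Prod>i\<in>I. f (z i))) = sets (Pi\<^sub>M I (\<lambda>_. density M f))"
    by (simp cong: sets_PiM_cong)
  fix A assume "\<And>i. i \<in> I \<Longrightarrow> A i \<in> sets (density M f)"
  hence A[measurable]: "\<And>i. i \<in> I \<Longrightarrow> A i \<in> sets M" by simp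
  have [measurable]: "Pi\<^sub>E I A \<in> sets (Pi\<^sub>M I (\<lambda>_. M))"
    using A \<open>finite I\<close> by (intro sets_PiM_I_finite) auto
  have "emeasure (density (Pi\<^sub>M I (\<lambda>_. M)) (\<lambda>z. \<Prod>i\<in>I. f (z i))) (Pi\<^sub>E I A) =
      (\<integral>\<^sup>+z. (\<Prod>i\<in>I. f (z i)) * indicator (Pi\<^sub>E I A) z \<partial>Pi\<^sub>M I (\<lambda>_. M))"
    by (rule emeasure_density) simp_all
  also have "\<dots> = (\<integral>\<^sup>+z. (\<Prod>i\<in>I. f (z i) * indicator (A i) (z i)) \<partial>Pi\<^sub>M I (\<lambda>_. M))"
  proof (rule nn_integral_cong)
    fix z assume "z \<in> space (Pi\<^sub>M I (\<lambda>_. M))"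
    hence "indicator (Pi\<^sub>E I A) z = (\<Prod>i\<in>I. indicator (A i) (z i) :: ennreal)"
      using \<open>finite I\<close>
      by (cases "\<forall>i\<in>I. z i \<in> A i")
        (auto simp: space_PiM PiE_iff indicator_def intro!: prod.neutral[symmetric] prod_zero[symmetric])
    thus "(\<Prod>i\<in>I. f (z i)) * indicator (Pi\<^sub>E I A) z = (\<Prod>i\<in>I. f (z i) * indicator (A i) (z i))"
      by (simp add: prod.distrib)
  qed
  also have "\<dots> = (\<Prod>i\<in>I. \<integral>\<^sup>+x. f x * indicator (A i) x \<partial>M)"
    using \<open>finite I\<close> by (intro P.product_nn_integral_prod) auto
  also have "\<dots> = (\<Prod>i\<in>I. emeasure (density M f) (A i))"
    by (intro prod.cong refl) (simp add: emeasure_density)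
  finally show "emeasure (density (Pi\<^sub>M I (\<lambda>_. M)) (\<lambda>z. \<Prod>i\<in>I. f (z i))) (Pi\<^sub>E I A) =
      (\<Prod>i\<in>I. emeasure (density M f) (A i))" .
qed (use assms in simp)

lemma sample_expectation_eq_integral_prod:
  assumes "prob_space M" and f[measurable]: "f \<in> borel_measurable M"
    and f0: "\<And>x. x \<in> space M \<Longrightarrow> 0 \<le> f x"
    and f1: "has_bochner_integral M f 1"
    and \<psi>[measurable]: "\<psi> \<in> borel_measurable (Pi\<^sub>M {1..n} (\<lambda>_. M))"
  shows "sample_expectation M n f \<psi> = (\<integral>z. (\<Prod>i\<in>{1..n}. f (z i)) * \<psi> z \<partial>Pi\<^sub>M {1..n} (\<lambda>_. M))"
proof -
  interpret prob_space M by fact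
  have "(\<integral>\<^sup>+x. ennreal (f x) \<partial>M) = ennreal 1"
    using f1 f0 by (subst nn_integral_eq_integral)
      (auto simp: has_bochner_integral_iff intro!: AE_I2)
  hence "prob_space (density M (\<lambda>x. ennreal (f x)))"
    by (intro prob_spaceI) (simp add: emeasure_density cong: nn_integral_cong)
  then interpret D: prob_space "density M (\<lambda>x. ennreal (f x))" .
  have "Pi\<^sub>M {1..n} (\<lambda>_. density M (\<lambda>x. ennreal (f x)))
      = density (Pi\<^sub>M {1..n} (\<lambda>_. M)) (\<lambda>z. \<Prod>i\<in>{1..n}. ennreal (f (z i)))"
    by (rule PiM_density) (auto simp: sigma_finite_measure_axioms D.sigma_finite_measure_axioms)
  also have "\<dots> = density (Pi\<^sub>M {1..n} (\<lambda>_. M)) (\<lambda>z. ennreal (\<Prod>i\<in>{1..n}. f (z i)))"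
    by (intro density_cong) (auto intro!: AE_I2 prod_ennreal f0 simp: space_PiM PiE_iff)
  finally have eq: "Pi\<^sub>M {1..n} (\<lambda>_. density M (\<lambda>x. ennreal (f x))) = \<dots>" .
  show ?thesis
    unfolding sample_expectation_def eq
    by (subst integral_density)
      (auto intro!: AE_I2 prod_nonneg f0 simp: space_PiM PiE_iff simp del: One_nat_def)
qed

text \<open>
  The sum of the two errors, averaged over \<open>E\<close>, is \<open>1 - \<integral> (L - 1) \<psi>\<close> for the mixture likelihood \<open>L\<close>
  of the sample. As \<open>0 \<le> \<psi> \<le> 1\<close>, the loss is at most \<open>\<integral> \<bar>L - 1\<bar>\<close>, hence at most the square root of
  \<open>\<integral> L\<^sup>2 - 1\<close>; and \<open>\<integral> L\<^sup>2\<close> is the average over pairs of \<open>n\<close>-th powers of overlaps. Some member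
  of the mixture is at least as bad as the average.
\<close>

lemma (in prob_space) testing_error_ge_of_second_moment:
  fixes f :: "'e \<Rightarrow> 'a \<Rightarrow> real"
  assumes E: "finite E" "E \<noteq> {}"
    and f[measurable]: "\<And>e. e \<in> E \<Longrightarrow> f e \<in> borel_measurable M"
    and f0: "\<And>e x. e \<in> E \<Longrightarrow> x \<in> space M \<Longrightarrow> 0 \<le> f e x"
    and fB: "\<And>e x. e \<in> E \<Longrightarrow> x \<in> space M \<Longrightarrow> f e x \<le> B"
    and f1: "\<And>e. e \<in> E \<Longrightarrow> has_bochner_integral M (f e) 1"
    and g: "\<And>x. x \<in> space M \<Longrightarrow> g x = 1"
    and \<psi>: "\<psi> \<in> tests M n"
    and t: "0 < t"
    and second_moment:
      "(\<Sum>d\<in>E. \<Sum>e\<in>E. (\<integral>x. f d x * f e x \<partial>M) ^ n) \<le> (1 + t\<^sup>2) * (real (card E))\<^sup>2"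
  shows "\<exists>e\<in>E. 1 - t \<le> sample_expectation M n g \<psi> + sample_expectation M n (f e) (\<lambda>z. 1 - \<psi> z)"
proof -
  define N where "N = Pi\<^sub>M {1..n} (\<lambda>_. M)"
  interpret P: product_prob_space "\<lambda>_. M" "{1..n}" ..
  interpret N: prob_space N unfolding N_def by (rule P.prob_space_axioms)
  have \<psi>01: "0 \<le> \<psi> z" "\<psi> z \<le> 1" if "z \<in> space N" for z
    using \<psi> that by (auto simp: tests_def N_def)
  have \<psi>m[measurable]: "\<psi> \<in> borel_measurable N" using \<psi> by (simp add: tests_def N_def)
  have comp: "z i \<in> space M" if "z \<in> space N" "i \<in> {1..n}" for z i
    using that by (auto simp: N_def space_PiM PiE_iff)
  define l where "l e z = (\<Prod>i\<in>{1..n}. f e (z i))" for e z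
  have lm[measurable]: "l e \<in> borel_measurable N" if "e \<in> E" for e
    unfolding l_def N_def using that by measurable
  have l0: "0 \<le> l e z" if "e \<in> E" "z \<in> space N" for e z
    unfolding l_def using that comp by (intro prod_nonneg) (auto intro: f0)
  have lB: "l e z \<le> B ^ n" if "e \<in> E" "z \<in> space N" for e z
    using prod_mono[of "{1..n}" "\<lambda>i. f e (z i)" "\<lambda>_. B"] that comp
    by (auto simp: l_def intro: f0 fB)
  define L where "L z = (\<Sum>e\<in>E. l e z) / card E" for z
  have cE: "0 < real (card E)" using E by (simp add: card_gt_0_iff)
  have Lm[measurable]: "L \<in> borel_measurable N" unfolding L_def by measurable
  have L0: "0 \<le> L z" if "z \<in> space N" for z
    unfolding L_def using that by (intro divide_nonneg_nonneg sum_nonneg l0) auto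
  have LB: "L z \<le> B ^ n" if "z \<in> space N" for z
    using sum_bounded_above[of E "\<lambda>e. l e z" "B ^ n"] that lB cE
    by (simp add: L_def field_simps)
  have bdd: "integrable N h" if "h \<in> borel_measurable N" "\<And>z. z \<in> space N \<Longrightarrow> \<bar>h z\<bar> \<le> C"
    for h :: "(nat \<Rightarrow> 'a) \<Rightarrow> real" and C :: real    using that by (intro N.integrable_const_bound[where B=C]) (auto intro!: AE_I2)
  have l_int: "integrable N (l e)" if "e \<in> E" for e
    using that l0 lB by (intro bdd[of _ "B^n"]) auto
  have l1: "(\<integral>z. l e z \<partial>N) = 1" if "e \<in> E" for e
    unfolding l_def N_def using f1[OF that]
    by (subst P.product_integral_prod) (auto simp: has_bochner_integral_iff)
  have ff: "integrable M (\<lambda>x. f d x * f e x)" if "d \<in> E" "e \<in> E" for d e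
  proof (rule integrable_const_bound[where B="B * B"], rule AE_I2)
    fix x assume x: "x \<in> space M"
    show "norm (f d x * f e x) \<le> B * B"
      using f0[OF that(1) x] f0[OF that(2) x] fB[OF that(1) x] fB[OF that(2) x]
      by (auto simp: abs_mult intro!: mult_mono)
  qed (use that in measurable)
  have ll: "(\<integral>z. l d z * l e z \<partial>N) = (\<integral>x. f d x * f e x \<partial>M) ^ n" if "d \<in> E" "e \<in> E" for d e
    unfolding l_def N_def prod.distrib[symmetric]
    by (subst P.product_integral_prod) (auto simp: ff that)
  have ll_int: "integrable N (\<lambda>z. l d z * l e z)" if "d \<in> E" "e \<in> E" for d e
  proof (rule bdd[of _ "B^n * B^n"])
    fix z assume z: "z \<in> space N"
    show "\<bar>l d z * l e z\<bar> \<le> B^n * B^n"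
      using l0[OF that(1) z] l0[OF that(2) z] lB[OF that(1) z] lB[OF that(2) z]
      by (auto simp: abs_mult intro!: mult_mono)
  qed (use that in measurable)
  have L_int: "integrable N L"
    using L0 LB by (intro bdd[of _ "B^n"]) auto
  have L1: "(\<integral>z. L z \<partial>N) = 1"
    unfolding L_def using cE by (simp add: l_int l1)
  have L_sq: "(L z)\<^sup>2 = (\<Sum>d\<in>E. \<Sum>e\<in>E. l d z * l e z) / (real (card E))\<^sup>2" for z
    by (simp add: L_def power2_eq_square sum_product)
  have L2_int: "integrable N (\<lambda>z. (L z)\<^sup>2)"
    unfolding L_sq by (intro Bochner_Integration.integrable_sum integrable_divide ll_int)
  have L2: "(\<integral>z. (L z)\<^sup>2 \<partial>N) \<le> 1 + t\<^sup>2"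
    unfolding L_sq using second_moment cE by (simp add: ll ll_int field_simps)
  have \<psi>_int: "integrable N \<psi>"
    using \<psi>01 by (intro bdd[of _ 1]) auto
  have L\<psi>_int: "integrable N (\<lambda>z. L z * \<psi> z)"
    using \<psi>01 L0 LB
    by (intro bdd[of _ "B^n"]) (auto simp: abs_mult intro!: order_trans[OF mult_left_le])
  have l\<psi>_int: "integrable N (\<lambda>z. l e z * (1 - \<psi> z))" if "e \<in> E" for e
    using \<psi>01 that l0 lB
    by (intro bdd[of _ "B^n"]) (auto simp: abs_mult intro!: order_trans[OF mult_left_le])
  have null: "sample_expectation M n g \<psi> = (\<integral>z. \<psi> z \<partial>N)"
  proof -
    have g_meas: "g \<in> borel_measurable M"
      using g by (subst measurable_cong[where g="\<lambda>_. 1"]) auto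
    have "has_bochner_integral M g 1"
      using g prob_space by (subst has_bochner_integral_cong[where g="\<lambda>_. 1" and N=M])
        (auto simp: has_bochner_integral_iff)
    hence "sample_expectation M n g \<psi> = (\<integral>z. (\<Prod>i\<in>{1..n}. g (z i)) * \<psi> z \<partial>N)"
      unfolding N_def using g g_meas \<psi>m
      by (intro sample_expectation_eq_integral_prod prob_space_axioms) (auto simp: N_def)
    also have "\<dots> = (\<integral>z. \<psi> z \<partial>N)"
      using comp g by (intro Bochner_Integration.integral_cong) auto
    finally show ?thesis .
  qed
  have alt: "sample_expectation M n (f e) (\<lambda>z. 1 - \<psi> z) = (\<integral>z. l e z * (1 - \<psi> z) \<partial>N)"
    if "e \<in> E" for e
    unfolding N_def l_def using that f0 f1 \<psi>m
    by (intro sample_expectation_eq_integral_prod prob_space_axioms) (auto simp: N_def)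
  (* Young's inequality with parameter t replaces Cauchy-Schwarz: the integral of the right-hand
     side is at most t as soon as the variance of L is at most t^2. *)
  have pointwise: "L z * \<psi> z - \<psi> z \<le> (t + ((L z)\<^sup>2 - 2 * L z + 1) / t) / 2" if "z \<in> space N" for z
  proof -
    have "L z * \<psi> z - \<psi> z \<le> \<bar>L z - 1\<bar> * \<psi> z"
      using \<psi>01[OF that] mult_right_mono[of "L z - 1" "\<bar>L z - 1\<bar>" "\<psi> z"] by (simp add: algebra_simps)
    also have "\<dots> \<le> \<bar>L z - 1\<bar>"
      using \<psi>01[OF that] by (simp add: mult_left_le)
    also have "\<dots> \<le> (t + (\<bar>L z - 1\<bar>)\<^sup>2 / t) / 2"
      using t zero_le_power2[of "t - \<bar>L z - 1\<bar>"] by (simp add: field_simps power2_eq_square)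
    finally show ?thesis by (simp add: power2_eq_square algebra_simps)
  qed
  have "(\<integral>z. L z * \<psi> z - \<psi> z \<partial>N) \<le> (\<integral>z. (t + ((L z)\<^sup>2 - 2 * L z + 1) / t) / 2 \<partial>N)"
    by (intro integral_mono pointwise integrable_divide Bochner_Integration.integrable_add
        Bochner_Integration.integrable_diff integrable_mult_right L\<psi>_int \<psi>_int L2_int L_int
        N.integrable_const)
  also have "\<dots> = (t + ((\<integral>z. (L z)\<^sup>2 \<partial>N) - 1) / t) / 2"
    by (simp add: L2_int L_int L1 N.prob_space)
  also have "\<dots> \<le> t"
    using L2 t by (simp add: field_simps power2_eq_square)
  finally have dev: "(\<integral>z. L z * \<psi> z \<partial>N) - (\<integral>z. \<psi> z \<partial>N) \<le> t"
    by (simp add: L\<psi>_int \<psi>_int)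
  have "(\<Sum>e\<in>E. (\<integral>z. l e z * (1 - \<psi> z) \<partial>N)) = (\<integral>z. (\<Sum>e\<in>E. l e z * (1 - \<psi> z)) \<partial>N)"
    by (simp add: l\<psi>_int)
  also have "\<dots> = (\<integral>z. card E * (L z - L z * \<psi> z) \<partial>N)"
    using cE by (intro Bochner_Integration.integral_cong)
      (simp_all add: L_def right_diff_distrib sum_subtractf sum_distrib_right)
  also have "\<dots> = card E * (1 - (\<integral>z. L z * \<psi> z \<partial>N))"
    by (simp add: L_int L\<psi>_int L1)
  finally have avg: "(\<Sum>e\<in>E. (\<integral>z. l e z * (1 - \<psi> z) \<partial>N)) = card E * (1 - (\<integral>z. L z * \<psi> z \<partial>N))" .
  show ?thesis
  proof (rule ccontr)
    assume "\<not> ?thesis"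
    hence "(\<integral>z. l e z * (1 - \<psi> z) \<partial>N) < 1 - t - (\<integral>z. \<psi> z \<partial>N)" if "e \<in> E" for e
      using that null alt by force
    hence "(\<Sum>e\<in>E. (\<integral>z. l e z * (1 - \<psi> z) \<partial>N)) < (\<Sum>e\<in>E. 1 - t - (\<integral>z. \<psi> z \<partial>N))"
      using E by (intro sum_strict_mono) auto
    hence "1 - (\<integral>z. L z * \<psi> z \<partial>N) < 1 - t - (\<integral>z. \<psi> z \<partial>N)"
      using cE unfolding avg by simp
    thus False using dev by simp
  qed
qed

section \<open>Averaging over random signs\<close>

lemma exp_add_exp_minus_le:
  fixes a :: real
  assumes "0 \<le> a" "a \<le> 1"
  shows "exp a + exp (- a) \<le> 2 * exp (a\<^sup>2)"
proof -
  have "exp (- a) \<le> 1 / (1 + a)"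
    using exp_ge_add_one_self[of a] assms by (simp add: exp_minus field_simps)
  also have "\<dots> \<le> 1 - a + a\<^sup>2"
    using assms by (simp add: field_simps power2_eq_square)
  finally have "exp a + exp (- a) \<le> 2 * (1 + a\<^sup>2)"
    using exp_bound[OF assms] by simp
  also have "\<dots> \<le> 2 * exp (a\<^sup>2)"
    by (intro mult_left_mono exp_ge_add_one_self) simp
  finally show ?thesis .
qed

abbreviation sign_vectors :: "'s set \<Rightarrow> ('s \<Rightarrow> real) set" where
  "sign_vectors S \<equiv> S \<rightarrow>\<^sub>E {-1, 1}"

lemma card_sign_vectors: "finite S \<Longrightarrow> card (sign_vectors S) = 2 ^ card S"
  by (simp add: card_PiE flip: numeral_2_eq_2)

text \<open>
  After \<open>1 + x \<le> exp x\<close> the exponential of the overlap factorises over the coordinates, so for fixed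
  \<open>d\<close> the average over \<open>e\<close> is a power of \<open>cosh (n b)\<close>: the first-order terms cancel and only
  \<open>(n b)\<^sup>2\<close> remains in each coordinate. The condition \<open>b * card S \<le> 1\<close> keeps the bases of the powers
  nonnegative.
\<close>

lemma sum_sign_overlap_power_le:
  fixes b :: real
  assumes S: "finite S" and b: "0 \<le> b" "b * card S \<le> 1" "n * b \<le> 1"
  shows "(\<Sum>d\<in>sign_vectors S. \<Sum>e\<in>sign_vectors S. (1 + b * (\<Sum>s\<in>S. d s * e s)) ^ n)
    \<le> exp (card S * (n * b)\<^sup>2) * (real (card (sign_vectors S)))\<^sup>2"
proof -
  have "(\<Sum>e\<in>sign_vectors S. (1 + b * (\<Sum>s\<in>S. d s * e s)) ^ n) \<le> (2 * exp ((n * b)\<^sup>2)) ^ card S"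
    if d: "d \<in> sign_vectors S" for d
  proof -
    have "(1 + b * (\<Sum>s\<in>S. d s * e s)) ^ n \<le> (\<Prod>s\<in>S. exp (n * b * (d s * e s)))"
      if e: "e \<in> sign_vectors S" for e
    proof -
      have "\<bar>\<Sum>s\<in>S. d s * e s\<bar> \<le> (\<Sum>s\<in>S. \<bar>d s * e s\<bar>)" by (rule sum_abs)
      also have "\<dots> = (\<Sum>s\<in>S. 1)" using d e by (intro sum.cong refl) (fastforce simp: PiE_iff abs_mult)
      finally have "\<bar>\<Sum>s\<in>S. d s * e s\<bar> \<le> card S" by simp
      hence "b * \<bar>\<Sum>s\<in>S. d s * e s\<bar> \<le> 1"
        using b mult_left_mono[of "\<bar>\<Sum>s\<in>S. d s * e s\<bar>" "card S" b] by linarith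
      hence "\<bar>b * (\<Sum>s\<in>S. d s * e s)\<bar> \<le> 1" using b by (simp add: abs_mult)
      hence "(1 + b * (\<Sum>s\<in>S. d s * e s)) ^ n \<le> exp (b * (\<Sum>s\<in>S. d s * e s)) ^ n"
        using exp_ge_add_one_self by (intro power_mono) auto
      also have "\<dots> = (\<Prod>s\<in>S. exp (n * b * (d s * e s)))"
        using S by (simp add: exp_sum[symmetric] exp_of_nat_mult[symmetric] sum_distrib_left mult_ac)
      finally show ?thesis .
    qed
    hence "(\<Sum>e\<in>sign_vectors S. (1 + b * (\<Sum>s\<in>S. d s * e s)) ^ n)
        \<le> (\<Sum>e\<in>sign_vectors S. \<Prod>s\<in>S. exp (n * b * (d s * e s)))"
      by (rule sum_mono)
    also have "\<dots> = (\<Prod>s\<in>S. \<Sum>v\<in>{-1, 1}. exp (n * b * (d s * v)))"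
      using S by (subst prod_sum_PiE) auto
    also have "\<dots> \<le> (\<Prod>s\<in>S. 2 * exp ((n * b)\<^sup>2))"
    proof (rule prod_mono)
      fix s assume "s \<in> S"
      hence "d s = -1 \<or> d s = 1" using d by (auto simp: PiE_iff)
      thus "0 \<le> (\<Sum>v\<in>{-1, 1}. exp (n * b * (d s * v))) \<and>
          (\<Sum>v\<in>{-1, 1}. exp (n * b * (d s * v))) \<le> 2 * exp ((n * b)\<^sup>2)"
        using exp_add_exp_minus_le[of "n * b"] b by (auto intro: add_nonneg_nonneg)
    qed
    finally show ?thesis by simp
  qed
  hence "(\<Sum>d\<in>sign_vectors S. \<Sum>e\<in>sign_vectors S. (1 + b * (\<Sum>s\<in>S. d s * e s)) ^ n)
      \<le> (\<Sum>d\<in>sign_vectors S. (2 * exp ((n * b)\<^sup>2)) ^ card S)"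
    by (rule sum_mono)
  also have "\<dots> = exp (card S * (n * b)\<^sup>2) * (real (card (sign_vectors S)))\<^sup>2"
    using S by (simp add: card_sign_vectors power_mult_distrib exp_of_nat_mult power2_eq_square)
  finally show ?thesis .
qed

section \<open>Expansions in a bounded product basis\<close>

text \<open>
  Only orthonormality, the constant functions and the uniform bound on the products are kept from
  the two bases. Since the product with a constant function is again a product, the bound passes to
  each factor, and every function below is bounded and therefore integrable.
\<close>

locale bounded_product_system =
  X: prob_space MX + Y: prob_space MY
  for MX :: "'x measure" and MY :: "'y measure" +
  fixes J :: "'j set" and K :: "'k set"
    and pX :: "'j \<Rightarrow> 'x \<Rightarrow> real" and pY :: "'k \<Rightarrow> 'y \<Rightarrow> real"
    and j\<^sub>0 :: 'j and k\<^sub>0 :: 'k and P :: real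
  assumes j\<^sub>0: "j\<^sub>0 \<in> J" and k\<^sub>0: "k\<^sub>0 \<in> K"
    and pX_measurable: "j \<in> J \<Longrightarrow> pX j \<in> borel_measurable MX"
    and pY_measurable: "k \<in> K \<Longrightarrow> pY k \<in> borel_measurable MY"
    and pX_orthonormal: "i \<in> J \<Longrightarrow> j \<in> J \<Longrightarrow> (\<integral>x. pX i x * pX j x \<partial>MX) = (if i = j then 1 else 0)"
    and pY_orthonormal: "h \<in> K \<Longrightarrow> k \<in> K \<Longrightarrow> (\<integral>y. pY h y * pY k y \<partial>MY) = (if h = k then 1 else 0)"
    and pX_const: "x \<in> space MX \<Longrightarrow> pX j\<^sub>0 x = 1"
    and pY_const: "y \<in> space MY \<Longrightarrow> pY k\<^sub>0 y = 1"
    and product_bound: "j \<in> J \<Longrightarrow> k \<in> K \<Longrightarrow> x \<in> space MX \<Longrightarrow> y \<in> space MY \<Longrightarrow> \<bar>pX j x * pY k y\<bar> \<le> P"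
begin

sublocale XY: pair_prob_space MX MY ..

abbreviation M where "M \<equiv> MX \<Otimes>\<^sub>M MY"

definition basis_fun :: "'j \<times> 'k \<Rightarrow> 'x \<times> 'y \<Rightarrow> real" where
  "basis_fun s = tensor (pX (fst s)) (pY (snd s))"

definition perturbation :: "('j \<times> 'k) set \<Rightarrow> ('j \<times> 'k \<Rightarrow> real) \<Rightarrow> 'x \<times> 'y \<Rightarrow> real" where
  "perturbation S a z = (\<Sum>s\<in>S. a s * basis_fun s z)"

lemma P_ge_1: "1 \<le> P"
  using X.not_empty Y.not_empty product_bound[OF j\<^sub>0 k\<^sub>0] by (fastforce simp: pX_const pY_const)

lemma pX_bound: "j \<in> J \<Longrightarrow> x \<in> space MX \<Longrightarrow> \<bar>pX j x\<bar> \<le> P"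
  using Y.not_empty product_bound[OF _ k\<^sub>0] by (fastforce simp: pY_const)

lemma pY_bound: "k \<in> K \<Longrightarrow> y \<in> space MY \<Longrightarrow> \<bar>pY k y\<bar> \<le> P"
  using X.not_empty product_bound[OF j\<^sub>0] by (fastforce simp: pX_const)

lemma integrable_pX: "j \<in> J \<Longrightarrow> integrable MX (pX j)"
  by (rule X.integrable_const_bound[where B=P]) (auto intro!: AE_I2 pX_bound pX_measurable)

lemma integrable_pY: "k \<in> K \<Longrightarrow> integrable MY (pY k)"
  by (rule Y.integrable_const_bound[where B=P]) (auto intro!: AE_I2 pY_bound pY_measurable)

lemma integral_pX: "j \<in> J \<Longrightarrow> (\<integral>x. pX j x \<partial>MX) = (if j = j\<^sub>0 then 1 else 0)"
  using pX_orthonormal[OF _ j\<^sub>0, of j] by (simp add: pX_const cong: Bochner_Integration.integral_cong)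

lemma integral_pY: "k \<in> K \<Longrightarrow> (\<integral>y. pY k y \<partial>MY) = (if k = k\<^sub>0 then 1 else 0)"
  using pY_orthonormal[OF _ k\<^sub>0, of k] by (simp add: pY_const cong: Bochner_Integration.integral_cong)

lemma basis_fun_measurable: "s \<in> J \<times> K \<Longrightarrow> basis_fun s \<in> borel_measurable M"
  using pX_measurable pY_measurable by (auto simp: basis_fun_def tensor_def)

lemma basis_fun_bound: "s \<in> J \<times> K \<Longrightarrow> z \<in> space M \<Longrightarrow> \<bar>basis_fun s z\<bar> \<le> P"
  using product_bound by (auto simp: basis_fun_def tensor_def space_pair_measure)

lemma basis_fun_const: "z \<in> space M \<Longrightarrow> basis_fun (j\<^sub>0, k\<^sub>0) z = 1"
  by (auto simp: basis_fun_def tensor_def space_pair_measure pX_const pY_const)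

lemma integrable_basis_fun_mult:
  assumes "s \<in> J \<times> K" "t \<in> J \<times> K"
  shows "integrable M (\<lambda>z. basis_fun s z * basis_fun t z)"
proof (rule XY.P.integrable_const_bound[where B="P * P"], rule AE_I2)
  fix z assume z: "z \<in> space M"
  show "norm (basis_fun s z * basis_fun t z) \<le> P * P"
    using basis_fun_bound[OF assms(1) z] basis_fun_bound[OF assms(2) z] P_ge_1 by (auto simp: abs_mult intro!: mult_mono)
qed (use assms basis_fun_measurable in measurable)

lemma integral_basis_fun_mult:
  assumes s: "s \<in> J \<times> K" and t: "t \<in> J \<times> K"
  shows "(\<integral>z. basis_fun s z * basis_fun t z \<partial>M) = (if s = t then 1 else 0)"
proof -
  obtain i h j k where st: "s = (i, h)" "t = (j, k)" by (cases s, cases t)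
  hence mem: "i \<in> J" "j \<in> J" "h \<in> K" "k \<in> K" using s t by auto
  have "(\<integral>z. basis_fun s z * basis_fun t z \<partial>M) = (\<integral>x. \<integral>y. (pX i x * pX j x) * (pY h y * pY k y) \<partial>MY \<partial>MX)"
    using XY.integral_fst'[OF integrable_basis_fun_mult[OF s t]] by (simp add: st basis_fun_def tensor_def mult_ac)
  also have "\<dots> = (\<integral>x. pX i x * pX j x \<partial>MX) * (\<integral>y. pY h y * pY k y \<partial>MY)"
    by simp
  finally show ?thesis
    using mem by (simp add: st pX_orthonormal pY_orthonormal)
qed

lemma perturbation_measurable:
  "S \<subseteq> J \<times> K \<Longrightarrow> perturbation S a \<in> borel_measurable M"
  unfolding perturbation_def by (intro borel_measurable_sum borel_measurable_times basis_fun_measurable) auto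

lemma perturbation_bound:
  assumes "S \<subseteq> J \<times> K" "z \<in> space M" "\<And>s. s \<in> S \<Longrightarrow> \<bar>a s\<bar> \<le> \<delta>"
  shows "\<bar>perturbation S a z\<bar> \<le> \<delta> * card S * P"
proof -
  have "\<bar>perturbation S a z\<bar> \<le> (\<Sum>s\<in>S. \<bar>a s * basis_fun s z\<bar>)"
    unfolding perturbation_def by (rule sum_abs)
  also have "\<dots> \<le> of_nat (card S) * (\<delta> * P)"
  proof (rule sum_bounded_above)
    fix s assume "s \<in> S"
    thus "\<bar>a s * basis_fun s z\<bar> \<le> \<delta> * P"
      using assms(3)[of s] basis_fun_bound[of s z] assms(1,2) order_trans[OF abs_ge_zero, of "a s" \<delta>]
      by (auto simp: abs_mult intro!: mult_mono)
  qed
  finally show ?thesis by (simp add: mult_ac)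
qed

lemma integrable_perturbation_basis_fun:
  "S \<subseteq> J \<times> K \<Longrightarrow> t \<in> J \<times> K \<Longrightarrow> integrable M (\<lambda>z. perturbation S a z * basis_fun t z)"
  unfolding perturbation_def sum_distrib_right
  by (auto simp: mult.assoc intro!: Bochner_Integration.integrable_sum integrable_mult_right integrable_basis_fun_mult)

lemma integral_perturbation_basis_fun:
  assumes "finite S" "S \<subseteq> J \<times> K" "t \<in> J \<times> K"
  shows "(\<integral>z. perturbation S a z * basis_fun t z \<partial>M) = (if t \<in> S then a t else 0)"
proof -
  have "(\<integral>z. perturbation S a z * basis_fun t z \<partial>M) = (\<Sum>s\<in>S. a s * (\<integral>z. basis_fun s z * basis_fun t z \<partial>M))"
    unfolding perturbation_def sum_distrib_right mult.assoc
    using assms by (subst Bochner_Integration.integral_sum) (auto intro!: integrable_basis_fun_mult)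
  also have "\<dots> = (\<Sum>s\<in>S. if s = t then a s else 0)"
    using assms by (intro sum.cong) (auto simp: integral_basis_fun_mult subset_eq)
  finally show ?thesis using assms by simp
qed

lemma integrable_perturbation_mult:
  "S \<subseteq> J \<times> K \<Longrightarrow> integrable M (\<lambda>z. perturbation S a z * perturbation S b z)"
  unfolding perturbation_def[of S b] sum_distrib_left
  by (auto simp: mult.left_commute[of "perturbation S a _"] 
      intro!: Bochner_Integration.integrable_sum integrable_mult_right integrable_perturbation_basis_fun)

lemma integral_perturbation_mult:
  assumes "finite S" "S \<subseteq> J \<times> K"
  shows "(\<integral>z. perturbation S a z * perturbation S b z \<partial>M) = (\<Sum>s\<in>S. a s * b s)"
proof -
  have "(\<integral>z. perturbation S a z * perturbation S b z \<partial>M) =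
      (\<Sum>s\<in>S. b s * (\<integral>z. perturbation S a z * basis_fun s z \<partial>M))"
    unfolding perturbation_def[of S b] sum_distrib_left mult.left_commute[of "perturbation S a _"]
    using assms by (subst Bochner_Integration.integral_sum) (auto intro!: integrable_perturbation_basis_fun)
  also have "\<dots> = (\<Sum>s\<in>S. a s * b s)"
    using assms by (intro sum.cong refl) (simp add: integral_perturbation_basis_fun subsetD)
  finally show ?thesis .
qed

end

section \<open>Densities perturbed by interactions\<close>

text \<open>
  Avoiding \<open>j\<^sub>0\<close> and \<open>k\<^sub>0\<close> makes the basis functions indexed by \<open>S\<close> orthogonal to every function of
  one variable alone, so that perturbing along them changes the dependence but not the marginals.
\<close>

locale interaction_set = bounded_product_system MX MY J K pX pY j\<^sub>0 k\<^sub>0 P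
  for MX :: "'x measure" and MY :: "'y measure" and J :: "'j set" and K :: "'k set"
    and pX pY j\<^sub>0 k\<^sub>0 P +
  fixes S :: "('j \<times> 'k) set"
  assumes finite_S: "finite S" and S_subset: "S \<subseteq> (J - {j\<^sub>0}) \<times> (K - {k\<^sub>0})"
begin

lemma S_subset_product: "S \<subseteq> J \<times> K"
  using S_subset by auto

lemma S_components:
  assumes "s \<in> S"
  shows "fst s \<in> J" "fst s \<noteq> j\<^sub>0" "snd s \<in> K" "snd s \<noteq> k\<^sub>0"
  using assms S_subset by (cases s; auto)+

definition perturbed :: "('j \<times> 'k \<Rightarrow> real) \<Rightarrow> 'x \<times> 'y \<Rightarrow> real" where
  "perturbed a z = 1 + perturbation S a z"

lemma perturbed_measurable: "perturbed a \<in> borel_measurable M"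
  unfolding perturbed_def[abs_def] using perturbation_measurable[OF S_subset_product] by simp

lemma integrable_perturbation: "integrable M (perturbation S a)"
  using integrable_perturbation_basis_fun[OF S_subset_product, of "(j\<^sub>0, k\<^sub>0)" a] j\<^sub>0 k\<^sub>0
  by (simp add: basis_fun_const cong: Bochner_Integration.integrable_cong)

lemma integral_perturbation: "(\<integral>z. perturbation S a z \<partial>M) = 0"
  using integral_perturbation_basis_fun[OF finite_S S_subset_product, of "(j\<^sub>0, k\<^sub>0)" a] j\<^sub>0 k\<^sub>0 S_subset
  by (auto simp: basis_fun_const cong: Bochner_Integration.integral_cong)

lemma has_integral_perturbed: "has_bochner_integral M (perturbed a) 1"
  unfolding perturbed_def[abs_def]
  by (auto simp: has_bochner_integral_iff integrable_perturbation integral_perturbation XY.P.prob_space)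

lemma integral_perturbed_mult:
  "(\<integral>z. perturbed a z * perturbed b z \<partial>M) = 1 + (\<Sum>s\<in>S. a s * b s)"
proof -
  have "(\<integral>z. perturbed a z * perturbed b z \<partial>M) =
      (\<integral>z. 1 + perturbation S a z + perturbation S b z + perturbation S a z * perturbation S b z \<partial>M)"
    by (simp add: perturbed_def algebra_simps)
  also have "\<dots> = 1 + (\<Sum>s\<in>S. a s * b s)"
    by (simp add: integrable_perturbation integral_perturbation XY.P.prob_space
        integrable_perturbation_mult[OF S_subset_product] integral_perturbation_mult[OF finite_S S_subset_product])
  finally show ?thesis .
qed

lemma marg_X_perturbed:
  assumes "x \<in> space MX"
  shows "marg_X MY (perturbed a) x = 1"
proof -
  have "marg_X MY (perturbed a) x = (\<integral>y. 1 + (\<Sum>s\<in>S. a s * pX (fst s) x * pY (snd s) y) \<partial>MY)"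
    by (simp add: marg_X_def perturbed_def perturbation_def basis_fun_def tensor_def mult.assoc)
  also have "\<dots> = 1 + (\<Sum>s\<in>S. a s * pX (fst s) x * (\<integral>y. pY (snd s) y \<partial>MY))"
    using S_subset
    by (subst Bochner_Integration.integral_add, simp, force intro!: integrable_pY)
      (subst Bochner_Integration.integral_sum, auto simp: Y.prob_space intro!: integrable_pY)
  also have "(\<Sum>s\<in>S. a s * pX (fst s) x * (\<integral>y. pY (snd s) y \<partial>MY)) = 0"
    by (intro sum.neutral) (simp add: S_components integral_pY)
  finally show ?thesis by simp
qed

lemma marg_Y_perturbed:
  assumes "y \<in> space MY"
  shows "marg_Y MX (perturbed a) y = 1"
proof -
  have "marg_Y MX (perturbed a) y = (\<integral>x. 1 + (\<Sum>s\<in>S. a s * pY (snd s) y * pX (fst s) x) \<partial>MX)"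
    by (simp add: marg_Y_def perturbed_def perturbation_def basis_fun_def tensor_def mult_ac)
  also have "\<dots> = 1 + (\<Sum>s\<in>S. a s * pY (snd s) y * (\<integral>x. pX (fst s) x \<partial>MX))"
    using S_subset
    by (subst Bochner_Integration.integral_add, simp, force intro!: integrable_pX)
      (subst Bochner_Integration.integral_sum, auto simp: X.prob_space intro!: integrable_pX)
  also have "(\<Sum>s\<in>S. a s * pY (snd s) y * (\<integral>x. pX (fst s) x \<partial>MX)) = 0"
    by (intro sum.neutral) (simp add: S_components integral_pX)
  finally show ?thesis by simp
qed

lemma dep_measure_perturbed: "dep_measure MX MY (perturbed a) = ennreal (\<Sum>s\<in>S. (a s)\<^sup>2)"
proof -
  have "dep_measure MX MY (perturbed a) = (\<integral>\<^sup>+z. ennreal ((perturbation S a z)\<^sup>2) \<partial>M)"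
    unfolding dep_measure_def
    by (intro nn_integral_cong)
      (auto simp: space_pair_measure marg_X_perturbed marg_Y_perturbed perturbed_def)
  also have "\<dots> = ennreal (\<integral>z. (perturbation S a z)\<^sup>2 \<partial>M)"
    using integrable_perturbation_mult[OF S_subset_product, of a a]
    by (intro nn_integral_eq_integral) (auto simp: power2_eq_square)
  finally show ?thesis
    using integral_perturbation_mult[OF finite_S S_subset_product, of a a] by (simp add: power2_eq_square)
qed

text \<open>
  The product of the marginal coefficients is nonzero only at \<open>(j\<^sub>0, k\<^sub>0)\<close>, where it is cancelled by the
  constant part of the density.
\<close>

lemma coeff_diff_perturbed:
  assumes j: "j \<in> J" and k: "k \<in> K"
  shows "coeff_diff MX MY (pX j) (pY k) (perturbed a) = (if (j, k) \<in> S then a (j, k) else 0)"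
proof -
  have jk: "(j, k) \<in> J \<times> K" "(j\<^sub>0, k\<^sub>0) \<in> J \<times> K" using j k j\<^sub>0 k\<^sub>0 by auto
  have "(\<integral>z. perturbed a z * tensor (pX j) (pY k) z \<partial>M)
      = (\<integral>z. basis_fun (j\<^sub>0, k\<^sub>0) z * basis_fun (j, k) z + perturbation S a z * basis_fun (j, k) z \<partial>M)"
    by (intro Bochner_Integration.integral_cong)
      (auto simp: basis_fun_const perturbed_def distrib_right basis_fun_def[of "(j, k)"])
  also have "\<dots> = (if j = j\<^sub>0 \<and> k = k\<^sub>0 then 1 else 0) + (if (j, k) \<in> S then a (j, k) else 0)"
    using jk
    by (subst Bochner_Integration.integral_add)
      (auto simp: integral_basis_fun_mult integral_perturbation_basis_fun[OF finite_S S_subset_product]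
        intro: integrable_basis_fun_mult integrable_perturbation_basis_fun[OF S_subset_product])
  also have "(if j = j\<^sub>0 \<and> k = k\<^sub>0 then 1 else 0) =
      (\<integral>x. marg_X MY (perturbed a) x * pX j x \<partial>MX) * (\<integral>y. marg_Y MX (perturbed a) y * pY k y \<partial>MY)"
    using j k by (simp add: marg_X_perturbed marg_Y_perturbed integral_pX integral_pY
        cong: Bochner_Integration.integral_cong)
  finally show ?thesis by (simp add: coeff_diff_def)
qed

lemma smoothness_perturbed:
  "smoothness MX MY J K pX pY \<theta> (perturbed a) = (\<Sum>s\<in>S. (\<theta> s)\<^sup>2 * ennreal ((a s)\<^sup>2))"
proof -
  have "smoothness MX MY J K pX pY \<theta> (perturbed a) = (\<Sum>\<^sub>\<infinity>s\<in>S. (\<theta> s)\<^sup>2 * ennreal ((a s)\<^sup>2))"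
    unfolding smoothness_def
    using S_subset by (intro infsum_cong_neutral) (auto simp: coeff_diff_perturbed)
  thus ?thesis by (simp add: finite_S)
qed

text \<open>
  Coefficients of equal size \<open>\<delta>\<close> spread the squared distance \<open>card S * \<delta>\<^sup>2\<close> evenly, so the smoothness
  sum is an average over \<open>S\<close> of terms each of which is at most \<open>r\<^sup>2\<close>.
\<close>

lemma perturbed_in_alternatives:
  fixes \<delta> \<rho> r A :: real
  assumes a: "\<And>s. s \<in> S \<Longrightarrow> \<bar>a s\<bar> = \<delta>"
    and small: "\<delta> * card S * P \<le> min 1 (A - 1)"
    and \<rho>: "\<rho>\<^sup>2 \<le> card S * \<delta>\<^sup>2"
    and \<theta>: "\<And>s. s \<in> S \<Longrightarrow> (\<theta> s)\<^sup>2 * ennreal (card S * \<delta>\<^sup>2) \<le> ennreal (r\<^sup>2)"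
    and S: "S \<noteq> {}" and A: "1 \<le> A"
  shows "perturbed a \<in> alternatives MX MY J K pX pY \<theta> r A \<rho>"
proof -
  have dev: "\<bar>perturbation S a z\<bar> \<le> min 1 (A - 1)" if "z \<in> space M" for z
    using perturbation_bound[OF S_subset_product that, of a \<delta>] a small by fastforce
  have sq: "(a s)\<^sup>2 = \<delta>\<^sup>2" if "s \<in> S" for s
    using a[OF that] power2_abs[of "a s"] by simp
  have "square_integrable M (perturbed a)"
    unfolding square_integrable_def
  proof (intro conjI perturbed_measurable XY.P.integrable_const_bound[where B="A\<^sup>2"] AE_I2)
    fix z assume "z \<in> space M"
    hence "\<bar>perturbed a z\<bar> \<le> A" using dev[of z] by (auto simp: perturbed_def)
    thus "norm ((perturbed a z)\<^sup>2) \<le> A\<^sup>2" using power_mono[of "\<bar>perturbed a z\<bar>" A 2] by simp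
  qed (use perturbed_measurable[of a] in measurable)
  moreover have "AE z in M. 0 \<le> perturbed a z"
    using dev by (intro AE_I2) (fastforce simp: perturbed_def)
  ultimately have "perturbed a \<in> density_class MX MY"
    by (simp add: density_class_def has_integral_perturbed)
  moreover have "ennreal (\<rho>\<^sup>2) \<le> dep_measure MX MY (perturbed a)"
    using \<rho> by (simp add: dep_measure_perturbed sq ennreal_leI)
  moreover have "smoothness MX MY J K pX pY \<theta> (perturbed a) \<le> ennreal (r\<^sup>2)"
  proof -
    have c: "0 < real (card S)" using S finite_S by (simp add: card_gt_0_iff)
    have "(\<Sum>s\<in>S. (\<theta> s)\<^sup>2 * ennreal ((a s)\<^sup>2)) \<le> (\<Sum>s\<in>S. ennreal (r\<^sup>2 / card S))"
    proof (rule sum_mono)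
      fix s assume s: "s \<in> S"
      have "(\<theta> s)\<^sup>2 * ennreal ((a s)\<^sup>2) = ((\<theta> s)\<^sup>2 * ennreal (card S * \<delta>\<^sup>2)) * ennreal (1 / card S)"
        using c by (simp add: sq[OF s] mult.assoc flip: ennreal_mult)
      also have "\<dots> \<le> ennreal (r\<^sup>2) * ennreal (1 / card S)"
        by (intro mult_right_mono \<theta> s) simp
      also have "\<dots> = ennreal (r\<^sup>2 / card S)"
        by (simp flip: ennreal_mult)
      finally show "(\<theta> s)\<^sup>2 * ennreal ((a s)\<^sup>2) \<le> ennreal (r\<^sup>2 / card S)" .
    qed
    also have "\<dots> = ennreal (\<Sum>s\<in>S. r\<^sup>2 / card S)" by (rule sum_ennreal) simp
    also have "(\<Sum>s\<in>S. r\<^sup>2 / card S) = r\<^sup>2" using c by simp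
    finally show ?thesis unfolding smoothness_perturbed .
  qed
  moreover have "sup_norm M (perturbed a) \<le> ennreal A"
    unfolding sup_norm_def using dev by (intro SUP_least ennreal_leI) (fastforce simp: perturbed_def)
  moreover have "sup_norm MX (marg_X MY (perturbed a)) \<le> ennreal A"
    unfolding sup_norm_def using A by (intro SUP_least ennreal_leI) (simp add: marg_X_perturbed)
  moreover have "sup_norm MY (marg_Y MX (perturbed a)) \<le> ennreal A"
    unfolding sup_norm_def using A by (intro SUP_least ennreal_leI) (simp add: marg_Y_perturbed)
  ultimately show ?thesis by (simp add: alternatives_def)
qed

text \<open>
  The signed perturbations form the mixture. Their overlaps \<open>1 + \<delta>\<^sup>2 \<langle>\<epsilon>, \<epsilon>'\<rangle>\<close> are those of the sign
  average with \<open>b = \<delta>\<^sup>2\<close>.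
\<close>

lemma minimax_risk_ge:
  fixes t \<delta> \<rho> r A :: real
  assumes t: "0 < t"
    and \<delta>: "0 \<le> \<delta>"
    and small: "\<delta> * card S * P \<le> min 1 (A - 1)"
    and \<rho>: "\<rho>\<^sup>2 \<le> card S * \<delta>\<^sup>2"
    and \<theta>: "\<And>s. s \<in> S \<Longrightarrow> (\<theta> s)\<^sup>2 * ennreal (card S * \<delta>\<^sup>2) \<le> ennreal (r\<^sup>2)"
    and S: "S \<noteq> {}" and A: "1 \<le> A"
    and n: "n * \<delta>\<^sup>2 \<le> 1" "exp (card S * (n * \<delta>\<^sup>2)\<^sup>2) \<le> 1 + t\<^sup>2"
  shows "ennreal (1 - t) \<le> minimax_risk MX MY J K pX pY (tensor (pX j\<^sub>0) (pY k\<^sub>0)) n \<theta> r A \<rho>"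
  unfolding minimax_risk_def
proof (rule INF_greatest)
  fix \<psi> assume \<psi>: "\<psi> \<in> tests M n"
  define f where "f \<epsilon> = perturbed (\<lambda>s. \<delta> * \<epsilon> s)" for \<epsilon>
  have abs_sign: "\<bar>\<delta> * \<epsilon> s\<bar> = \<delta>" if "\<epsilon> \<in> sign_vectors S" "s \<in> S" for \<epsilon> s
    using that \<delta> by (fastforce simp: PiE_iff abs_mult)
  have dev: "\<bar>perturbation S (\<lambda>s. \<delta> * \<epsilon> s) z\<bar> \<le> min 1 (A - 1)"
    if "\<epsilon> \<in> sign_vectors S" "z \<in> space M" for \<epsilon> z
    using perturbation_bound[OF S_subset_product that(2), of "\<lambda>s. \<delta> * \<epsilon> s" \<delta>] abs_sign[OF that(1)] small
    by fastforce
  (* The uniform bound on the perturbation dominates its L^2 norm because P and card S are at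
     least 1. *)
  have "\<delta>\<^sup>2 * card S \<le> 1"
  proof -
    have "1 \<le> card S" using S finite_S by (simp add: Suc_le_eq card_gt_0_iff)
    hence "\<delta>\<^sup>2 * card S * 1 \<le> \<delta>\<^sup>2 * card S * (card S * P\<^sup>2)"
      using P_ge_1 mult_mono[of 1 "real (card S)" 1 "P\<^sup>2"] by (intro mult_left_mono) auto
    also have "\<dots> = (\<delta> * card S * P)\<^sup>2" by (simp add: power2_eq_square mult_ac)
    also have "\<dots> \<le> 1" using small \<delta> P_ge_1 by (intro power_le_one) auto
    finally show ?thesis by simp
  qed
  hence "(\<Sum>d\<in>sign_vectors S. \<Sum>\<epsilon>\<in>sign_vectors S. (1 + \<delta>\<^sup>2 * (\<Sum>s\<in>S. d s * \<epsilon> s)) ^ n)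
      \<le> exp (card S * (n * \<delta>\<^sup>2)\<^sup>2) * (real (card (sign_vectors S)))\<^sup>2"
    using n finite_S by (intro sum_sign_overlap_power_le) auto
  also have "\<dots> \<le> (1 + t\<^sup>2) * (real (card (sign_vectors S)))\<^sup>2"
    using n by (intro mult_right_mono) auto
  finally have second_moment:
    "(\<Sum>d\<in>sign_vectors S. \<Sum>\<epsilon>\<in>sign_vectors S. (\<integral>z. f d z * f \<epsilon> z \<partial>M) ^ n)
      \<le> (1 + t\<^sup>2) * (real (card (sign_vectors S)))\<^sup>2"
    by (simp add: f_def integral_perturbed_mult sum_distrib_left power2_eq_square mult_ac)
  have "sign_vectors S \<noteq> {}" by (simp add: PiE_eq_empty_iff)
  have "\<exists>\<epsilon>\<in>sign_vectors S. 1 - t \<le> sample_expectation M n (tensor (pX j\<^sub>0) (pY k\<^sub>0)) \<psi>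
      + sample_expectation M n (f \<epsilon>) (\<lambda>z. 1 - \<psi> z)"
  proof (rule XY.P.testing_error_ge_of_second_moment[OF _ _ _ _ _ _ _ \<psi> t second_moment])
    fix \<epsilon> z assume "\<epsilon> \<in> sign_vectors S" "z \<in> space M"
    from dev[OF this] show "0 \<le> f \<epsilon> z" "f \<epsilon> z \<le> A" by (auto simp: f_def perturbed_def)
  qed (use finite_S \<open>sign_vectors S \<noteq> {}\<close> basis_fun_const in \<open>auto simp: f_def basis_fun_def perturbed_measurable
        has_integral_perturbed intro!: finite_PiE\<close>)
  then obtain \<epsilon> where \<epsilon>: "\<epsilon> \<in> sign_vectors S"
    and err: "1 - t \<le> sample_expectation M n (tensor (pX j\<^sub>0) (pY k\<^sub>0)) \<psi>
      + sample_expectation M n (f \<epsilon>) (\<lambda>z. 1 - \<psi> z)" by blast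
  have alt: "f \<epsilon> \<in> alternatives MX MY J K pX pY \<theta> r A \<rho>"
    unfolding f_def by (rule perturbed_in_alternatives[OF abs_sign[OF \<epsilon>] small \<rho> \<theta> S A])
  have sp: "space (Pi\<^sub>M {1..n} (\<lambda>_. density M g)) = space (Pi\<^sub>M {1..n} (\<lambda>_. M))" for g
    by (simp add: space_PiM)
  have nonneg: "0 \<le> sample_expectation M n g \<psi>" "0 \<le> sample_expectation M n g (\<lambda>z. 1 - \<psi> z)" for g
    using \<psi> unfolding sample_expectation_def tests_def
    by (auto intro!: integral_nonneg_AE AE_I2 simp: sp simp del: One_nat_def)
  have "ennreal (1 - t) \<le> ennreal (sample_expectation M n (tensor (pX j\<^sub>0) (pY k\<^sub>0)) \<psi>)
      + ennreal (sample_expectation M n (f \<epsilon>) (\<lambda>z. 1 - \<psi> z))"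
    using err nonneg by (simp flip: ennreal_plus add: ennreal_leI)
  also have "\<dots> \<le> ennreal (sample_expectation M n (tensor (pX j\<^sub>0) (pY k\<^sub>0)) \<psi>)
      + (SUP g\<in>alternatives MX MY J K pX pY \<theta> r A \<rho>. ennreal (sample_expectation M n g (\<lambda>z. 1 - \<psi> z)))"
    by (intro add_left_mono SUP_upper alt)
  finally show "ennreal (1 - t) \<le> \<dots>" .
qed

end

section \<open>The lower bound on the separation rate\<close>

lemma ennreal_mult_le_of_le_divide:
  fixes w r :: real and \<theta> :: ennreal
  assumes "0 \<le> w" "0 \<le> r" "\<theta> < \<infinity>" "ennreal w \<le> ennreal r / \<theta>"
  shows "\<theta> * ennreal w \<le> ennreal r"
proof (cases "\<theta> = 0")
  case False
  have "\<theta> * ennreal w \<le> \<theta> * (ennreal r / \<theta>)"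
    using assms by (intro mult_left_mono) auto
  also have "\<dots> = ennreal r"
    using assms False by (simp add: ennreal_times_divide mult.commute[of \<theta>] ennreal_mult_divide_eq)
  finally show ?thesis .
qed simp

text \<open>
  With \<open>t = (1 - \<gamma>) / 2\<close>, a risk of at least \<open>1 - t = (1 + \<gamma>) / 2\<close> exceeds \<open>\<gamma>\<close> strictly. The second
  moment of the mixture is at most \<open>exp (c\<^sup>4) \<le> exp c \<le> 1 + 2 * c\<close>, which is why \<open>c\<close> is taken to be at most
  \<open>t\<^sup>2 / 2\<close>; the condition \<open>c \<le> A - 1\<close> keeps the densities below \<open>A\<close>. The same densities serve every
  smaller radius, since the class of alternatives shrinks as the radius grows.
\<close>

lemma (in interaction_set) minimax_separation_ge:
  fixes \<gamma> A c r w :: real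
  assumes \<gamma>: "0 < \<gamma>" "\<gamma> < 1" and A: "1 < A"
    and c: "0 \<le> c" "c \<le> ((1 - \<gamma>) / 2)\<^sup>2 / 2" "c \<le> A - 1"
    and S: "S \<noteq> {}" and n: "1 \<le> n" and w: "0 \<le> w" and r: "0 \<le> r"
    and smooth: "\<And>s. s \<in> S \<Longrightarrow> \<theta> s * ennreal w \<le> ennreal r"
    and indist: "w \<le> card S powr (1/4) / n powr (1/2)"
    and small: "w * sqrt (card S) * P \<le> 1"
  shows "ennreal (c * w)
    \<le> minimax_separation MX MY J K pX pY (tensor (pX j\<^sub>0) (pY k\<^sub>0)) n \<gamma> \<theta> r A"
proof -
  define t where "t = (1 - \<gamma>) / 2"
  have t: "0 < t" "t \<le> 1 / 2" using \<gamma> by (auto simp: t_def)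
  have "t\<^sup>2 \<le> (1 / 2)\<^sup>2" using t by (intro power_mono) auto
  hence c8: "c \<le> 1 / 8" and ct: "2 * c \<le> t\<^sup>2" using c by (auto simp: t_def power2_eq_square)
  define m where "m = real (card S)"
  have m: "1 \<le> m" using S finite_S by (simp add: m_def Suc_le_eq card_gt_0_iff)
  define \<delta> where "\<delta> = c * w / sqrt m"
  have m\<delta>: "m * \<delta>\<^sup>2 = (c * w)\<^sup>2" using m by (simp add: \<delta>_def power_divide)
  have \<delta>m: "\<delta> * m * P = c * (w * sqrt m * P)"
    using m real_sqrt_mult_self[of m] by (simp add: \<delta>_def field_simps)
  have \<delta>_small: "\<delta> * card S * P \<le> min 1 (A - 1)"
    using mult_left_le[OF small c(1)] c8 c(3) unfolding m_def[symmetric] \<delta>m by (simp add: m_def)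
  have n\<delta>: "n * \<delta>\<^sup>2 \<le> c\<^sup>2 / sqrt m"
  proof -
    have "w\<^sup>2 \<le> (m powr (1/4) / n powr (1/2))\<^sup>2"
      using indist w by (intro power_mono) (auto simp: m_def)
    also have "\<dots> = sqrt m / n"
      using m n by (simp add: power_divide powr_half_sqrt power2_eq_square flip: powr_add)
    finally have "n * w\<^sup>2 \<le> sqrt m" using n by (simp add: field_simps)
    hence "c\<^sup>2 * (n * w\<^sup>2) / m \<le> c\<^sup>2 * sqrt m / m"
      using m by (intro divide_right_mono mult_left_mono) auto
    moreover have "n * \<delta>\<^sup>2 = c\<^sup>2 * (n * w\<^sup>2) / m"
      using m by (simp add: \<delta>_def power_divide power_mult_distrib)
    moreover have "c\<^sup>2 * sqrt m / m = c\<^sup>2 / sqrt m"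
      using m by (simp add: divide_eq_eq eq_divide_eq mult.assoc)
    ultimately show ?thesis by simp
  qed
  have c2: "c\<^sup>2 \<le> c" "c ^ 4 \<le> c"
    using c8 c(1) power_decreasing[of 1 2 c] power_decreasing[of 1 4 c] by auto
  have n\<delta>1: "n * \<delta>\<^sup>2 \<le> 1"
  proof -
    have "c\<^sup>2 / sqrt m \<le> c\<^sup>2 / 1" using m by (intro divide_left_mono) auto
    thus ?thesis using n\<delta> c2 c8 by linarith
  qed
  have "m * (n * \<delta>\<^sup>2)\<^sup>2 \<le> m * (c\<^sup>2 / sqrt m)\<^sup>2"
    using n\<delta> m by (intro mult_left_mono power_mono) auto
  also have "\<dots> = c ^ 4" using m by (simp add: power_divide)
  finally have mn: "m * (n * \<delta>\<^sup>2)\<^sup>2 \<le> c" using c2 by simp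
  have "exp (m * (n * \<delta>\<^sup>2)\<^sup>2) \<le> exp c" using mn by simp
  also have "\<dots> \<le> 1 + 2 * c" using c8 c(1) by (intro real_exp_bound_lemma) auto
  finally have ex: "exp (card S * (n * \<delta>\<^sup>2)\<^sup>2) \<le> 1 + t\<^sup>2" using ct by (simp add: m_def)
  have \<theta>: "(\<theta> s)\<^sup>2 * ennreal (card S * \<delta>\<^sup>2) \<le> ennreal (r\<^sup>2)" if "s \<in> S" for s
  proof -
    have "\<theta> s * ennreal (c * w) \<le> \<theta> s * ennreal w"
      using c8 w by (intro mult_left_mono ennreal_leI) (auto intro!: mult_left_le_one_le c)
    also note smooth[OF that]
    finally have "(\<theta> s * ennreal (c * w))\<^sup>2 \<le> (ennreal r)\<^sup>2" by (intro power_mono) auto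
    thus ?thesis
      unfolding m_def[symmetric] m\<delta> using c w r by (simp add: power_mult_distrib ennreal_power)
  qed
  show ?thesis
    unfolding minimax_separation_def
  proof (rule Inf_greatest, clarify, rule ccontr)
    fix \<rho> :: real
    assume \<rho>: "0 < \<rho>" "minimax_risk MX MY J K pX pY (tensor (pX j\<^sub>0) (pY k\<^sub>0)) n \<theta> r A \<rho> \<le> ennreal \<gamma>"
      and "\<not> ennreal (c * w) \<le> ennreal \<rho>"
    hence "\<rho> < c * w" by (simp add: ennreal_leI not_le) 
    hence "\<rho>\<^sup>2 \<le> card S * \<delta>\<^sup>2"
      unfolding m_def[symmetric] m\<delta> using \<rho> by (intro power_mono) auto
    hence "ennreal (1 - t) \<le> minimax_risk MX MY J K pX pY (tensor (pX j\<^sub>0) (pY k\<^sub>0)) n \<theta> r A \<rho>"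
      using t A c w S \<delta>_small \<theta> n\<delta>1 ex m
      by (intro minimax_risk_ge[where \<delta>=\<delta>]) (auto simp: \<delta>_def)
    hence "ennreal (1 - t) \<le> ennreal \<gamma>" using \<rho>(2) by (rule order_trans)
    thus False using \<gamma> by (simp add: t_def field_simps)
  qed
qed

theorem theorem12:
  fixes \<gamma> A :: real
  assumes "0 < \<gamma>" and "\<gamma> < 1" and "A > 1"
  shows "\<exists>c::real. c > 0 \<and>
    (\<forall>(MX :: 'x measure) (MY :: 'y measure) (J :: 'j set) (K :: 'k set)
       (pX :: 'j \<Rightarrow> 'x \<Rightarrow> real) (pY :: 'k \<Rightarrow> 'y \<Rightarrow> real) (j\<^sub>0 :: 'j) (k\<^sub>0 :: 'k)
       (\<theta> :: 'j \<times> 'k \<Rightarrow> ennreal) (r :: real) (\<omega> :: nat \<Rightarrow> 'j \<times> 'k) (n :: nat).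
       prob_space MX \<and> prob_space MY \<and>
       separable_measure MX \<and> separable_measure MY \<and>
       countable J \<and> countable K \<and>
       orthonormal_basis MX J pX \<and> orthonormal_basis MY K pY \<and>
       j\<^sub>0 \<in> J \<and> k\<^sub>0 \<in> K \<and>
       (\<forall>x\<in>space MX. pX j\<^sub>0 x = 1) \<and> (\<forall>y\<in>space MY. pY k\<^sub>0 y = 1) \<and>
       basis_bound MX MY J K pX pY < \<infinity> \<and>
       r > 0 \<and>
       (\<forall>T::real. T > 0 \<longrightarrow> finite {jk \<in> J \<times> K. \<theta> jk \<le> ennreal T}) \<and>
       (\<forall>j\<in>J. \<forall>k\<in>K. j = j\<^sub>0 \<or> k = k\<^sub>0 \<longrightarrow> \<theta> (j, k) = \<infinity>) \<and>
       infinite {jk \<in> J \<times> K. \<theta> jk < \<infinity>} \<and>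
       bij_betw \<omega> {1..} {jk \<in> J \<times> K. \<theta> jk < \<infinity>} \<and>
       (\<forall>l\<ge>1. \<forall>m\<ge>l. \<theta> (\<omega> l) \<le> \<theta> (\<omega> m)) \<and>
       n \<ge> 1
       \<longrightarrow>
       minimax_separation MX MY J K pX pY (tensor (pX j\<^sub>0) (pY k\<^sub>0)) n \<gamma> \<theta> r A
         \<ge> ennreal c *
           (SUP m\<in>{1..}. min (ennreal r / \<theta> (\<omega> m))
              (min (ennreal (real m powr (1/4) / real n powr (1/2)))
                   (1 / (ennreal (real m powr (1/2)) * basis_bound MX MY J K pX pY)))))"
proof (intro exI conjI allI impI)
  define c where "c = min (((1 - \<gamma>) / 2)\<^sup>2 / 2) (A - 1)"
  show "0 < c" using assms by (simp add: c_def)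
  have c_le: "c \<le> ((1 - \<gamma>) / 2)\<^sup>2 / 2" "c \<le> A - 1" unfolding c_def by (rule min.cobounded1, rule min.cobounded2)
  fix MX :: "'x measure" and MY :: "'y measure" and J :: "'j set" and K :: "'k set"
    and pX :: "'j \<Rightarrow> 'x \<Rightarrow> real" and pY :: "'k \<Rightarrow> 'y \<Rightarrow> real" and j\<^sub>0 :: 'j and k\<^sub>0 :: 'k
    and \<theta> :: "'j \<times> 'k \<Rightarrow> ennreal" and r :: real and \<omega> :: "nat \<Rightarrow> 'j \<times> 'k" and n :: nat
  let ?B = "basis_bound MX MY J K pX pY"
  assume H: "prob_space MX \<and> prob_space MY \<and>
       separable_measure MX \<and> separable_measure MY \<and>
       countable J \<and> countable K \<and>
       orthonormal_basis MX J pX \<and> orthonormal_basis MY K pY \<and>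
       j\<^sub>0 \<in> J \<and> k\<^sub>0 \<in> K \<and>
       (\<forall>x\<in>space MX. pX j\<^sub>0 x = 1) \<and> (\<forall>y\<in>space MY. pY k\<^sub>0 y = 1) \<and>
       ?B < \<infinity> \<and>
       r > 0 \<and>
       (\<forall>T::real. T > 0 \<longrightarrow> finite {jk \<in> J \<times> K. \<theta> jk \<le> ennreal T}) \<and>
       (\<forall>j\<in>J. \<forall>k\<in>K. j = j\<^sub>0 \<or> k = k\<^sub>0 \<longrightarrow> \<theta> (j, k) = \<infinity>) \<and>
       infinite {jk \<in> J \<times> K. \<theta> jk < \<infinity>} \<and>
       bij_betw \<omega> {1..} {jk \<in> J \<times> K. \<theta> jk < \<infinity>} \<and>
       (\<forall>l\<ge>1. \<forall>m\<ge>l. \<theta> (\<omega> l) \<le> \<theta> (\<omega> m)) \<and>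
       n \<ge> 1"
  define P where "P = enn2real ?B"
  have B: "?B = ennreal P" using H by (simp add: P_def)
  have "0 \<le> P" by (simp add: P_def)
  have "bounded_product_system MX MY J K pX pY j\<^sub>0 k\<^sub>0 P"
    unfolding bounded_product_system_def bounded_product_system_axioms_def
  proof (intro conjI allI impI)
    fix j k x y assume mem: "j \<in> J" "k \<in> K" "x \<in> space MX" "y \<in> space MY"
    hence "ennreal \<bar>pX j x * pY k y\<bar> \<le> sup_norm (MX \<Otimes>\<^sub>M MY) (tensor (pX j) (pY k))"
      unfolding sup_norm_def
      by - (rule SUP_upper2[of "(x, y)"], simp_all add: space_pair_measure tensor_def)
    also have "\<dots> \<le> ?B"
      unfolding basis_bound_def using mem by - (rule SUP_upper2[of "(j, k)"], simp_all)
    finally have "ennreal \<bar>pX j x * pY k y\<bar> \<le> ?B" .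
    thus "\<bar>pX j x * pY k y\<bar> \<le> P" by (simp add: B \<open>0 \<le> P\<close>)
  qed (use H in \<open>auto simp: orthonormal_basis_def square_integrable_def\<close>)
  then interpret bounded_product_system MX MY J K pX pY j\<^sub>0 k\<^sub>0 P .
  have \<omega>: "\<omega> l \<in> J \<times> K" "\<theta> (\<omega> l) < \<infinity>" if "1 \<le> l" for l
    using H that by (auto dest!: bij_betwE)
  have inj: "inj_on \<omega> {1..}" using H by (simp add: bij_betw_def)
  let ?v = "\<lambda>m. min (ennreal r / \<theta> (\<omega> m))
    (min (ennreal (real m powr (1/4) / real n powr (1/2))) (1 / (ennreal (real m powr (1/2)) * ?B)))"
  have "ennreal c * ?v m
      \<le> minimax_separation MX MY J K pX pY (tensor (pX j\<^sub>0) (pY k\<^sub>0)) n \<gamma> \<theta> r A"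
    if m: "1 \<le> m" for m
  proof -
    define S where "S = \<omega> ` {1..m}"
    have card: "card S = m"
      unfolding S_def using inj by (subst card_image) (auto intro: inj_on_subset)
    interpret interaction_set MX MY J K pX pY j\<^sub>0 k\<^sub>0 P S
    proof
      show "S \<subseteq> (J - {j\<^sub>0}) \<times> (K - {k\<^sub>0})"
      proof
        fix s assume "s \<in> S"
        hence "s \<in> J \<times> K" "\<theta> s < \<infinity>" using \<omega> by (auto simp: S_def)
        thus "s \<in> (J - {j\<^sub>0}) \<times> (K - {k\<^sub>0})" using H by (cases s) auto
      qed
    qed (simp add: S_def)
    (* The second term of the minimum is finite, even where \<theta> (\<omega> m) = 0 makes the first one
       infinite. *)
    define w where "w = enn2real (?v m)"
    have v: "?v m = ennreal w"
      unfolding w_def by (rule ennreal_enn2real[symmetric]) (simp add: min_less_iff_disj)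
    have w0: "0 \<le> w" by (simp add: w_def)
    have "ennreal w \<le> ennreal r / \<theta> (\<omega> m)" by (simp flip: v)
    hence m_smooth: "\<theta> (\<omega> m) * ennreal w \<le> ennreal r"
      using H \<omega>(2)[OF m] w0 by (intro ennreal_mult_le_of_le_divide) auto
    have smooth: "\<theta> s * ennreal w \<le> ennreal r" if s: "s \<in> S" for s
    proof -
      have "\<theta> s \<le> \<theta> (\<omega> m)" using s H by (auto simp: S_def)
      thus ?thesis using m_smooth by (meson mult_right_mono order_trans zero_le)
    qed
    have "ennreal w \<le> ennreal (real m powr (1/4) / real n powr (1/2))"
      unfolding v[symmetric] by (simp add: min.coboundedI2)
    hence indist: "w \<le> real (card S) powr (1/4) / real n powr (1/2)" by (simp add: card)
    have "ennreal w \<le> 1 / (ennreal (real m powr (1/2)) * ?B)"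
      unfolding v[symmetric] by (simp add: min.coboundedI2)
    also have "\<dots> = ennreal (1 / (sqrt m * P))"
      using m P_ge_1 divide_ennreal[of 1 "sqrt m * P"]
      by (simp add: B powr_half_sqrt flip: ennreal_mult)
    finally have "w \<le> 1 / (sqrt m * P)" using P_ge_1 by simp
    hence small: "w * sqrt (card S) * P \<le> 1"
      using m P_ge_1 by (simp add: card field_simps)
    have "S \<noteq> {}" using m by (auto simp: S_def)
    hence "ennreal (c * w)
        \<le> minimax_separation MX MY J K pX pY (tensor (pX j\<^sub>0) (pY k\<^sub>0)) n \<gamma> \<theta> r A"
      using assms H w0 smooth indist small \<open>0 < c\<close>
      by (intro minimax_separation_ge c_le) auto
    thus ?thesis using \<open>0 < c\<close> w0 by (simp add: v ennreal_mult)
  qed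
  thus "ennreal c * (SUP m\<in>{1..}. ?v m)
      \<le> minimax_separation MX MY J K pX pY (tensor (pX j\<^sub>0) (pY k\<^sub>0)) n \<gamma> \<theta> r A"
    by (subst SUP_mult_left_ennreal) (auto intro!: SUP_least)
qed

end
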